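(* Let $p_0=p_{f_0}\in\mathcal{P}$, suppose assumptions (A)–(D) (listed in the context) hold with $\varepsilon=1$, let $(X_a)_{a=1}^n$ be samples drawn i.i.d. from $p_0$, let $\lambda>0$, and let $$f_{\lambda,n}=\arg\inf_{f\in\mathcal{H}}\hat J_\lambda(f),\qquad \hat J_\lambda(f):=\tfrac12\langle f,\hat Cf\rangle_{\mathcal{H}}+\langle f,\hat\xi\rangle_{\mathcal{H}}+J(p_0\|q_0)+\tfrac\lambda2\|f\|_{\mathcal{H}}^2,$$ where $\hat C:=\frac1n\sum_{a=1}^n\sum_{i=1}^d\partial_ik(X_a,\cdot)\otimes\partial_ik(X_a,\cdot)$ and $\hat\xi:=\frac1n\sum_{a=1}^n\sum_{i=1}^d\left(\partial_ik(X_a,\cdot)\,\partial_i\log q_0(X_a)+\partial_i^2k(X_a,\cdot)\right)$. Then $$f_{\lambda,n}=-\frac{\hat\xi}{\lambda}+\sum_{a=1}^n\sum_{i=1}^d\beta_{(a-1)d+i}\,\partial_ik(X_a,\cdot),$$ where $\boldsymbol\beta=(\beta_{(a-1)d+i})_{a,i}\in\mathbb{R}^{nd}$ is obtained by solving $$(\boldsymbol G+n\lambda I)\boldsymbol\beta=\boldsymbol h/\lambda$$ with $(\boldsymbol G)_{(a-1)d+i,(b-1)d+j}=\partial_i\partial_{j+d}k(X_a,X_b)$ and $$(\boldsymbol h)_{(a-1)d+i}=\langle\hat\xi,\partial_ik(X_a,\cdot)\rangle_{\mathcal{H}}=\frac1n\sum_{b=1}^n\sum_{j=1}^d\left(\partial_i\partial_{j+d}^2k(X_a,X_b)+\partial_i\partial_{j+d}k(X_a,X_b)\,\partial_j\log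 q_0(X_b)\right).$$
   Context: Family: $q_0$ is a probability density on $\Omega\subseteq\mathbb{R}^d$; $\mathcal{H}$ is the RKHS on $\Omega$ with reproducing kernel $k$; $A(f):=\log\int_\Omega e^{f}q_0\,dx$; $\mathcal{F}:=\{f\in\mathcal{H}:e^{A(f)}<\infty\}$; $p_f:=e^{f-A(f)}q_0$; $\mathcal{P}:=\{p_f:f\in\mathcal{F}\}$. $J(p\|q)=\frac12\int_\Omega p\,\|\nabla\log p-\nabla\log q\|_2^2\,dx$. Derivatives: $[d]=\{1,\dots,d\}$; for $k$ on $\Omega\times\Omega$, $\partial_i$ and $\partial_{i+d}$ denote partial derivatives in the $i$-th coordinate of the first and second argument, respectively; $\partial_ik(x,\cdot)$ and $\partial_i^2k(x,\cdot)$ (derivatives in the first argument) are elements of $\mathcal{H}$; $\partial^{\alpha,\alpha}k:=\partial_1^{\alpha_1}\cdots\partial_d^{\alpha_d}\partial_{1+d}^{\alpha_1}\cdots\partial_{2d}^{\alpha_d}k$. For $u,v\in\mathcal{H}$, $(u\otimes v)w=u\langle v,w\rangle_{\mathcal{H}}$. Assumptions: (A) $\Omega$ is a non-empty open subset of $\mathbb{R}^d$ with a piecewise smooth boundary $\partial\Omega:=\overline\Omega\setminus\Omega$. (B) $p_0$ is continuously extendible to $\overline\Omega$; $k$ is twice continuously differentiable on $\Omega\times\Omega$ (i.e. $\partial^{\alpha,\alpha}k$ exists and is continuous for $|\alpha|\le2$) with continuous extension of $\partial^{\alpha,\alpha}k$ to $\overline\Omega\times\overline\Omega$ for $|\alpha|\le2$.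 (C) For all $i\in[d]$: $\partial_i\partial_{i+d}k(x,x)p_0(x)=0$ for $x\in\partial\Omega$, and $\sqrt{\partial_i\partial_{i+d}k(x,x)}\,p_0(x)=o(\|x\|_2^{1-d})$ as $x\in\Omega$, $\|x\|_2\to\infty$. (D) ($\varepsilon$-integrability) $q_0\in C^1(\Omega)$, and for some $\varepsilon\ge1$ and all $i\in[d]$, the functions $x\mapsto\partial_i\partial_{i+d}k(x,x)$, $\sqrt{\partial_i^2\partial_{i+d}^2k(x,x)}$ and $\sqrt{\partial_i\partial_{i+d}k(x,x)}\,\partial_i\log q_0(x)$ belong to $L^\varepsilon(\Omega,p_0)$. *)

theory Defs
  imports "HOL-Probability.Probability" "HOL-Library.Landau_Symbols"
begin

text \<open>Derivatives along a direction \<open>v\<close>; with \<open>v\<close> a coordinate vector these are the partial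
  derivatives. \<open>iter_pd [v\<^sub>1, \<dots>, v\<^sub>m] f\<close> is \<open>\<partial>\<^sub>v\<^sub>1 \<dots> \<partial>\<^sub>v\<^sub>m f\<close>, the last direction being applied
  first.\<close>

definition pd :: "'a::real_normed_vector \<Rightarrow> ('a \<Rightarrow> 'b::real_normed_vector) \<Rightarrow> 'a \<Rightarrow> 'b" where
  "pd v f x = vector_derivative (\<lambda>t. f (x + t *\<^sub>R v)) (at 0)"

definition pd_exists :: "'a::real_normed_vector \<Rightarrow> ('a \<Rightarrow> 'b::real_normed_vector) \<Rightarrow> 'a \<Rightarrow> bool" where
  "pd_exists v f x \<longleftrightarrow> (\<lambda>t. f (x + t *\<^sub>R v)) differentiable (at 0)"

primrec iter_pd :: "'a::real_normed_vector list \<Rightarrow> ('a \<Rightarrow> 'b::real_normed_vector) \<Rightarrow> 'a \<Rightarrow> 'b" where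
  "iter_pd [] f = f"
| "iter_pd (v # vs) f = pd v (iter_pd vs f)"

primrec iter_pd_exists ::
    "'a::real_normed_vector list \<Rightarrow> ('a \<Rightarrow> 'b::real_normed_vector) \<Rightarrow> 'a set \<Rightarrow> bool" where
  "iter_pd_exists [] f U \<longleftrightarrow> True"
| "iter_pd_exists (v # vs) f U \<longleftrightarrow>
     iter_pd_exists vs f U \<and> (\<forall>x\<in>U. pd_exists v (iter_pd vs f) x)"

definition C1_on :: "(real ^ 'd) set \<Rightarrow> (real ^ 'd \<Rightarrow> 'b::real_normed_vector) \<Rightarrow> bool" where
  "C1_on U f \<longleftrightarrow>
     (\<forall>i. (\<forall>x\<in>U. pd_exists (axis i 1) f x) \<and> continuous_on U (pd (axis i 1) f))"

definition grad :: "(real ^ 'd \<Rightarrow> real) \<Rightarrow> real ^ 'd \<Rightarrow> real ^ 'd" where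
  "grad f x = (\<chi> i. pd (axis i 1) f x)"

text \<open>The directions of \<open>\<partial>\<^sub>i\<close> and \<open>\<partial>\<^sub>i\<^sub>+\<^sub>d\<close> for functions of a pair \<open>(x, y)\<close>.\<close>

definition dir1 :: "'d \<Rightarrow> (real ^ 'd) \<times> (real ^ 'd)" where
  "dir1 i = (axis i 1, 0)"

definition dir2 :: "'d \<Rightarrow> (real ^ 'd) \<times> (real ^ 'd)" where
  "dir2 i = (0, axis i 1)"

text \<open>The directions of \<open>\<partial>\<^bsup>\<alpha>,\<alpha>\<^esup> = \<partial>\<^sub>1\<^bsup>\<alpha>\<^sub>1\<^esup> \<dots> \<partial>\<^sub>d\<^bsup>\<alpha>\<^sub>d\<^esup> \<partial>\<^sub>1\<^sub>+\<^sub>d\<^bsup>\<alpha>\<^sub>1\<^esup> \<dots> \<partial>\<^sub>2\<^sub>d\<^bsup>\<alpha>\<^sub>d\<^esup>\<close>. The linear order on the index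
  type \<open>'d\<close> plays the role of the order of \<open>1, \<dots>, d\<close>.\<close>

definition multi_dirs ::
    "('d::{finite,linorder} \<Rightarrow> nat) \<Rightarrow>
     ((real ^ 'd::{finite,linorder}) \<times> (real ^ 'd::{finite,linorder})) list" where
  "multi_dirs \<alpha> =
     concat (map (\<lambda>i. replicate (\<alpha> i) (dir1 i)) (sorted_list_of_set UNIV)) @
     concat (map (\<lambda>i. replicate (\<alpha> i) (dir2 i)) (sorted_list_of_set UNIV))"

definition cont_extendible :: "'a::topological_space set \<Rightarrow> ('a \<Rightarrow> real) \<Rightarrow> bool" where
  "cont_extendible S f \<longleftrightarrow> (\<exists>g. continuous_on (closure S) g \<and> (\<forall>x\<in>S. g x = f x))"

text \<open>Unique on \<open>closure S\<close> when it exists; arbitrary elsewhere.\<close>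

definition cont_extension :: "'a::topological_space set \<Rightarrow> ('a \<Rightarrow> real) \<Rightarrow> 'a \<Rightarrow> real" where
  "cont_extension S f = (SOME g. continuous_on (closure S) g \<and> (\<forall>x\<in>S. g x = f x))"

text \<open>A smooth piece is a parametrized hypersurface: the image of the closed \<open>(d - 1)\<close>-dimensional
  unit cube, realized as a coordinate face of the unit cube of \<open>\<real>\<^sup>d\<close>, under a \<open>C\<^sup>1\<close> map which is
  injective and regular on the relative interior of the face. Smoothness is taken as \<open>C\<^sup>1\<close>, so
  that boundaries with pieces of higher smoothness are included. The family of pieces is only
  required to be locally finite because the open set may be unbounded, and it may be empty, as
  for the whole space.\<close>

definition cube_face :: "'d \<Rightarrow> (real ^ 'd) set" where
  "cube_face i = {x. x $ i = 0 \<and> (\<forall>j. 0 \<le> x $ j \<and> x $ j \<le> 1)}"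

definition smooth_piece :: "(real ^ 'd) set \<Rightarrow> bool" where
  "smooth_piece S \<longleftrightarrow>
     (\<exists>(\<psi> :: real ^ 'd \<Rightarrow> real ^ 'd) i W.
        open W \<and> cube_face i \<subseteq> W \<and> C1_on W \<psi> \<and> S = \<psi> ` cube_face i \<and>
        inj_on \<psi> (rel_interior (cube_face i)) \<and>
        (\<forall>x\<in>rel_interior (cube_face i). \<forall>v. v $ i = 0 \<longrightarrow> v \<noteq> 0 \<longrightarrow> pd v \<psi> x \<noteq> 0))"

definition piecewise_smooth_boundary :: "(real ^ 'd) set \<Rightarrow> bool" where
  "piecewise_smooth_boundary \<Omega> \<longleftrightarrow>
     (\<exists>\<S>. locally_finite_in euclidean \<S> \<and> (\<forall>S\<in>\<S>. smooth_piece S) \<and>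
          \<Union>\<S> = closure \<Omega> - \<Omega>)"

text \<open>The RKHS on \<open>\<Omega>\<close> with kernel \<open>k\<close> is a real Hilbert space \<open>'h\<close> whose elements are
  identified, through the linear and injective map \<open>fn\<close>, with functions on \<open>\<Omega>\<close>
  (the values of \<open>fn f\<close> outside \<open>\<Omega>\<close> carry no meaning).\<close>

locale rkhs =
  fixes \<Omega> :: "'a set"
    and fn :: "'h::{real_inner,complete_space} \<Rightarrow> 'a \<Rightarrow> real"
    and k :: "'a \<times> 'a \<Rightarrow> real"
  assumes linear_fn: "x \<in> \<Omega> \<Longrightarrow> linear (\<lambda>f. fn f x)"
    and fn_inject: "(\<And>x. x \<in> \<Omega> \<Longrightarrow> fn f x = fn g x) \<Longrightarrow> f = g"
    and reproducing:
      "x \<in> \<Omega> \<Longrightarrow> \<exists>u. (\<forall>y\<in>\<Omega>. fn u y = k (x, y)) \<and> (\<forall>f. fn f x = f \<bullet> u)"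

text \<open>A function \<open>g\<close> on \<open>\<Omega>\<close> as an element of the RKHS, provided that it belongs to it.\<close>

definition in_rkhs :: "'a set \<Rightarrow> ('h \<Rightarrow> 'a \<Rightarrow> real) \<Rightarrow> ('a \<Rightarrow> real) \<Rightarrow> bool" where
  "in_rkhs \<Omega> fn g \<longleftrightarrow> (\<exists>u. \<forall>y\<in>\<Omega>. fn u y = g y)"

definition rkhs_elem :: "'a set \<Rightarrow> ('h \<Rightarrow> 'a \<Rightarrow> real) \<Rightarrow> ('a \<Rightarrow> real) \<Rightarrow> 'h" where
  "rkhs_elem \<Omega> fn g = (THE u. \<forall>y\<in>\<Omega>. fn u y = g y)"

definition dk_fun :: "((real ^ 'd) \<times> (real ^ 'd) \<Rightarrow> real) \<Rightarrow> 'd \<Rightarrow> real ^ 'd \<Rightarrow> real ^ 'd \<Rightarrow> real" where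
  "dk_fun k i x = (\<lambda>y. iter_pd [dir1 i] k (x, y))"

definition ddk_fun :: "((real ^ 'd) \<times> (real ^ 'd) \<Rightarrow> real) \<Rightarrow> 'd \<Rightarrow> real ^ 'd \<Rightarrow> real ^ 'd \<Rightarrow> real" where
  "ddk_fun k i x = (\<lambda>y. iter_pd [dir1 i, dir1 i] k (x, y))"

definition outer :: "'h::real_inner \<Rightarrow> 'h \<Rightarrow> 'h \<Rightarrow> 'h" where
  "outer u v w = (v \<bullet> w) *\<^sub>R u"

definition prob_density_on :: "(real ^ 'd) set \<Rightarrow> (real ^ 'd \<Rightarrow> real) \<Rightarrow> bool" where
  "prob_density_on \<Omega> q \<longleftrightarrow>
     (\<forall>x\<in>\<Omega>. 0 \<le> q x) \<and> set_integrable lborel \<Omega> q \<and> (LINT x:\<Omega>|lborel. q x) = 1"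

text \<open>The set \<open>\<F>\<close> of \<open>f\<close> with \<open>e\<^bsup>A(f)\<^esup> = \<integral> e\<^sup>f q\<^sub>0 < \<infinity>\<close>; the integrand is nonnegative.\<close>

definition expfam_dom ::
    "(real ^ 'd) set \<Rightarrow> ('h \<Rightarrow> real ^ 'd \<Rightarrow> real) \<Rightarrow> (real ^ 'd \<Rightarrow> real) \<Rightarrow> 'h set" where
  "expfam_dom \<Omega> fn q0 = {f. set_integrable lborel \<Omega> (\<lambda>x. exp (fn f x) * q0 x)}"

definition log_partition ::
    "(real ^ 'd) set \<Rightarrow> ('h \<Rightarrow> real ^ 'd \<Rightarrow> real) \<Rightarrow> (real ^ 'd \<Rightarrow> real) \<Rightarrow> 'h \<Rightarrow> real" where
  "log_partition \<Omega> fn q0 f = ln (LINT x:\<Omega>|lborel. exp (fn f x) * q0 x)"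

definition expfam_density ::
    "(real ^ 'd) set \<Rightarrow> ('h \<Rightarrow> real ^ 'd \<Rightarrow> real) \<Rightarrow> (real ^ 'd \<Rightarrow> real) \<Rightarrow> 'h \<Rightarrow> real ^ 'd \<Rightarrow> real" where
  "expfam_density \<Omega> fn q0 f x = exp (fn f x - log_partition \<Omega> fn q0 f) * q0 x"

definition fisher_div :: "(real ^ 'd) set \<Rightarrow> (real ^ 'd \<Rightarrow> real) \<Rightarrow> (real ^ 'd \<Rightarrow> real) \<Rightarrow> real" where
  "fisher_div \<Omega> p q =
     1 / 2 * (LINT x:\<Omega>|lborel.
                p x * (norm (grad (\<lambda>x. ln (p x)) x - grad (\<lambda>x. ln (q x)) x))\<^sup>2)"

definition assumption_A :: "(real ^ 'd) set \<Rightarrow> bool" where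
  "assumption_A \<Omega> \<longleftrightarrow> \<Omega> \<noteq> {} \<and> open \<Omega> \<and> piecewise_smooth_boundary \<Omega>"

definition assumption_B ::
    "(real ^ 'd::{finite,linorder}) set \<Rightarrow> ((real ^ 'd::{finite,linorder}) \<times> (real ^ 'd::{finite,linorder}) \<Rightarrow> real) \<Rightarrow>
     (real ^ 'd::{finite,linorder} \<Rightarrow> real) \<Rightarrow> bool" where
  "assumption_B \<Omega> k p0 \<longleftrightarrow>
     cont_extendible \<Omega> p0 \<and>
     (\<forall>\<alpha>. (\<Sum>i\<in>UNIV. \<alpha> i) \<le> 2 \<longrightarrow>
        iter_pd_exists (multi_dirs \<alpha>) k (\<Omega> \<times> \<Omega>) \<and>
        continuous_on (\<Omega> \<times> \<Omega>) (iter_pd (multi_dirs \<alpha>) k) \<and>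
        cont_extendible (\<Omega> \<times> \<Omega>) (iter_pd (multi_dirs \<alpha>) k))"

text \<open>On the boundary, the values are those of the continuous extensions.\<close>

definition assumption_C ::
    "(real ^ 'd) set \<Rightarrow> ((real ^ 'd) \<times> (real ^ 'd) \<Rightarrow> real) \<Rightarrow> (real ^ 'd \<Rightarrow> real) \<Rightarrow> bool" where
  "assumption_C \<Omega> k p0 \<longleftrightarrow>
     (\<forall>i. (\<forall>x \<in> closure \<Omega> - \<Omega>.
             cont_extension (\<Omega> \<times> \<Omega>) (iter_pd [dir1 i, dir2 i] k) (x, x) *
             cont_extension \<Omega> p0 x = 0) \<and>
          (\<lambda>x. sqrt (iter_pd [dir1 i, dir2 i] k (x, x)) * p0 x)
             \<in> o[inf at_infinity (principal \<Omega>)](\<lambda>x. norm x powr (1 - real CARD('d))))"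

text \<open>Membership in \<open>L\<^sup>\<epsilon>(\<Omega>, p)\<close>. Measurability and integrability are stated for the products
  with \<open>p\<close>, so the values of \<open>g\<close> on the \<open>p\<close>-null set \<open>{p = 0}\<close> do not matter; there
  \<open>log q\<^sub>0\<close> below may be undefined.\<close>

definition Leps :: "real \<Rightarrow> (real ^ 'd) set \<Rightarrow> (real ^ 'd \<Rightarrow> real) \<Rightarrow> (real ^ 'd \<Rightarrow> real) \<Rightarrow> bool" where
  "Leps \<epsilon> \<Omega> p g \<longleftrightarrow>
     set_borel_measurable lborel \<Omega> (\<lambda>x. g x * p x) \<and>
     set_integrable lborel \<Omega> (\<lambda>x. \<bar>g x\<bar> powr \<epsilon> * p x)"

definition assumption_D ::
    "real \<Rightarrow> (real ^ 'd) set \<Rightarrow> ((real ^ 'd) \<times> (real ^ 'd) \<Rightarrow> real) \<Rightarrow> (real ^ 'd \<Rightarrow> real) \<Rightarrow>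
     (real ^ 'd \<Rightarrow> real) \<Rightarrow> bool" where
  "assumption_D \<epsilon> \<Omega> k q0 p0 \<longleftrightarrow>
     C1_on \<Omega> q0 \<and> 1 \<le> \<epsilon> \<and>
     (\<forall>i. Leps \<epsilon> \<Omega> p0 (\<lambda>x. iter_pd [dir1 i, dir2 i] k (x, x)) \<and>
          Leps \<epsilon> \<Omega> p0 (\<lambda>x. sqrt (iter_pd [dir1 i, dir1 i, dir2 i, dir2 i] k (x, x))) \<and>
          Leps \<epsilon> \<Omega> p0 (\<lambda>x. sqrt (iter_pd [dir1 i, dir2 i] k (x, x)) *
                           grad (\<lambda>x. ln (q0 x)) x $ i))"

text \<open>The sample is a family \<open>x\<close> over a finite index type \<open>'n\<close>, so \<open>n = CARD('n)\<close>; vectors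
  and matrices over \<open>(a - 1) d + i\<close> are indexed by the pairs \<open>(a, i)\<close>.\<close>

definition C_hat ::
    "(real ^ 'd) set \<Rightarrow> ('h::real_inner \<Rightarrow> real ^ 'd \<Rightarrow> real) \<Rightarrow>
     ((real ^ 'd) \<times> (real ^ 'd) \<Rightarrow> real) \<Rightarrow> ('n::finite \<Rightarrow> real ^ 'd) \<Rightarrow> 'h \<Rightarrow> 'h" where
  "C_hat \<Omega> fn k x f =
     (1 / real CARD('n)) *\<^sub>R
       (\<Sum>a\<in>UNIV. \<Sum>i\<in>UNIV.
          outer (rkhs_elem \<Omega> fn (dk_fun k i (x a))) (rkhs_elem \<Omega> fn (dk_fun k i (x a))) f)"

definition xi_hat ::
    "(real ^ 'd) set \<Rightarrow> ('h::real_inner \<Rightarrow> real ^ 'd \<Rightarrow> real) \<Rightarrow>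
     ((real ^ 'd) \<times> (real ^ 'd) \<Rightarrow> real) \<Rightarrow> (real ^ 'd \<Rightarrow> real) \<Rightarrow> ('n::finite \<Rightarrow> real ^ 'd) \<Rightarrow> 'h" where
  "xi_hat \<Omega> fn k q0 x =
     (1 / real CARD('n)) *\<^sub>R
       (\<Sum>a\<in>UNIV. \<Sum>i\<in>UNIV.
          (grad (\<lambda>x. ln (q0 x)) (x a) $ i) *\<^sub>R rkhs_elem \<Omega> fn (dk_fun k i (x a)) +
          rkhs_elem \<Omega> fn (ddk_fun k i (x a)))"

definition J_hat ::
    "(real ^ 'd) set \<Rightarrow> ('h::real_inner \<Rightarrow> real ^ 'd \<Rightarrow> real) \<Rightarrow>
     ((real ^ 'd) \<times> (real ^ 'd) \<Rightarrow> real) \<Rightarrow> (real ^ 'd \<Rightarrow> real) \<Rightarrow> (real ^ 'd \<Rightarrow> real) \<Rightarrow> real \<Rightarrow>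
     ('n::finite \<Rightarrow> real ^ 'd) \<Rightarrow> 'h \<Rightarrow> real" where
  "J_hat \<Omega> fn k q0 p0 lam x f =
     1 / 2 * (f \<bullet> C_hat \<Omega> fn k x f) + f \<bullet> xi_hat \<Omega> fn k q0 x + fisher_div \<Omega> p0 q0 +
     lam / 2 * (norm f)\<^sup>2"

definition G_mat ::
    "((real ^ 'd) \<times> (real ^ 'd) \<Rightarrow> real) \<Rightarrow> ('n::finite \<Rightarrow> real ^ 'd) \<Rightarrow>
     real ^ ('n \<times> 'd) ^ ('n \<times> 'd)" where
  "G_mat k x = (\<chi> r c. iter_pd [dir1 (snd r), dir2 (snd c)] k (x (fst r), x (fst c)))"

definition h_vec ::
    "(real ^ 'd) set \<Rightarrow> ('h::real_inner \<Rightarrow> real ^ 'd \<Rightarrow> real) \<Rightarrow>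
     ((real ^ 'd) \<times> (real ^ 'd) \<Rightarrow> real) \<Rightarrow> (real ^ 'd \<Rightarrow> real) \<Rightarrow> ('n::finite \<Rightarrow> real ^ 'd) \<Rightarrow>
     real ^ ('n \<times> 'd)" where
  "h_vec \<Omega> fn k q0 x =
     (\<chi> r. xi_hat \<Omega> fn k q0 x \<bullet> rkhs_elem \<Omega> fn (dk_fun k (snd r) (x (fst r))))"

end

theory Submission
  imports Defs
begin

text \<open>The estimate splits into an analytic and a linear-algebraic half.

The analytic half says that the kernel derivatives belong to \<open>\<H>\<close> and that their inner products
are mixed partial derivatives of \<open>k\<close>. Let \<open>\<Phi>(x) = k(x, \<cdot>)\<close>, so that \<open>k(x, y) = \<langle>\<Phi>(x), \<Phi>(y)\<rangle>\<close> and
\<open>f(x) = \<langle>f, \<Phi>(x)\<rangle>\<close>. Put \<open>S\<^sub>t = \<Delta>\<^sub>t\<^sup>m \<Phi> / t\<^sup>m\<close>, where \<open>\<Delta>\<^sub>t\<close> is the forward difference along a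
direction \<open>v\<close> at \<open>x\<close>. Then \<open>\<langle>S\<^sub>t, S\<^sub>s\<rangle>\<close> is a double difference quotient of \<open>k\<close>, and the mean value
theorem in each argument makes it a value of \<open>\<partial>\<^sup>m\<^sup>,\<^sup>m k\<close> near \<open>(x, x)\<close>. By continuity it
converges as \<open>s, t \<rightarrow> 0\<close>, so \<open>\<parallel>S\<^sub>t - S\<^sub>s\<parallel>\<^sup>2 \<rightarrow> 0\<close> and \<open>S\<^sub>t\<close> has a limit \<open>D\<close> in the complete space
\<open>\<H>\<close> (\<open>feature_map_derivative_exists\<close>). Pairing with \<open>\<Phi>(y)\<close> identifies \<open>D\<close> with the function
\<open>\<partial>\<^sub>1\<^sup>m k(x, \<cdot>)\<close>. For \<open>m = 1\<close> this is differentiability of \<open>\<Phi>\<close> along \<open>v\<close> in norm, hence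
\<open>\<langle>\<partial>\<^sub>i k(x, \<cdot>), w\<rangle> = \<partial>\<^sub>i \<langle>\<Phi>(x), w\<rangle>\<close> for all \<open>w \<in> \<H>\<close>; taking for \<open>w\<close> a derivative of order \<open>1\<close> or
\<open>2\<close> gives the entries of \<open>G\<close> and \<open>h\<close> (\<open>inner_deriv_features\<close>).

Differences of order \<open>m\<close> are used rather than iterated first differences because the hypotheses
provide the partial derivatives only in one order, with all derivatives in the second argument taken
first.

The linear-algebraic half: \<open>G\<close> is a Gram matrix, so \<open>G + n\<lambda>I\<close> is positive definite and \<open>\<beta>\<close>
exists uniquely. With \<open>e\<^sub>r\<close> the kernel derivatives and \<open>g = -\<xi>/\<lambda> + \<Sum> \<beta>\<^sub>r e\<^sub>r\<close>, the linear system
says \<open>\<langle>e\<^sub>r, g\<rangle> = -n\<lambda>\<beta>\<^sub>r\<close>, which is exactly \<open>C g + \<xi> + \<lambda> g = 0\<close>. The functional is quadratic with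
positive definite second-order part, so \<open>g\<close> is its only minimizer
(\<open>ridge_minimizer_representer\<close>).\<close>

section \<open>Iterated forward differences\<close>

definition fwd_diff :: "real \<Rightarrow> (real \<Rightarrow> 'b::real_vector) \<Rightarrow> real \<Rightarrow> 'b" where
  "fwd_diff t f a = f (a + t) - f a"

lemma inner_fwd_diff_funpow:
  fixes f :: "real \<Rightarrow> 'h::real_inner"
  shows "(fwd_diff t ^^ m) f a \<bullet> w = (fwd_diff t ^^ m) (\<lambda>u. f u \<bullet> w) a"
  by (induction m arbitrary: a) (simp_all add: fwd_diff_def inner_diff_left)

lemma inner_fwd_diff_funpow_both:
  fixes f :: "real \<Rightarrow> 'h::real_inner"
  shows "(fwd_diff t ^^ m) f a \<bullet> (fwd_diff s ^^ m) f b =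
    (fwd_diff s ^^ m) (\<lambda>v. (fwd_diff t ^^ m) (\<lambda>u. f u \<bullet> f v) a) b"
proof -
  have "(fwd_diff t ^^ m) f a \<bullet> (fwd_diff s ^^ m) f b =
      (fwd_diff s ^^ m) (\<lambda>v. f v \<bullet> (fwd_diff t ^^ m) f a) b"
    by (metis inner_commute inner_fwd_diff_funpow)
  moreover have "f v \<bullet> (fwd_diff t ^^ m) f a = (fwd_diff t ^^ m) (\<lambda>u. f u \<bullet> f v) a" for v
    by (metis inner_commute inner_fwd_diff_funpow)
  ultimately show ?thesis
    by simp
qed

text \<open>The iterated difference at \<open>a\<close> samples the function only at \<open>a, a + t, \<dots>, a + m t\<close>. The
enclosing interval is used instead of these points because the mean value lemmas need
intervals anyway.\<close>

lemma fwd_diff_funpow_cong: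
  assumes "\<And>u. \<bar>u - a\<bar> \<le> real m * \<bar>t\<bar> \<Longrightarrow> f u = g u"
  shows "(fwd_diff t ^^ m) f a = (fwd_diff t ^^ m) g a"
  using assms
proof (induction m arbitrary: a)
  case (Suc m)
  have "(fwd_diff t ^^ m) f (a + t) = (fwd_diff t ^^ m) g (a + t)"
    by (rule Suc.IH, rule Suc.prems) (auto simp: algebra_simps)
  moreover have "(fwd_diff t ^^ m) f a = (fwd_diff t ^^ m) g a"
    by (rule Suc.IH, rule Suc.prems) (auto simp: algebra_simps)
  ultimately show ?case
    by (simp add: fwd_diff_def[of t "(fwd_diff t ^^ m) _"])
qed simp

lemma fwd_diff_mean_value:
  fixes f f' :: "real \<Rightarrow> real"
  assumes deriv: "\<And>u. \<bar>u - a\<bar> \<le> \<bar>t\<bar> \<Longrightarrow> (f has_real_derivative f' u) (at u)"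
  shows "\<exists>\<xi>. \<bar>\<xi> - a\<bar> \<le> \<bar>t\<bar> \<and> fwd_diff t f a = t * f' \<xi>"
proof (cases "t = 0")
  case True
  then show ?thesis by (auto simp: fwd_diff_def)
next
  case False
  consider "t > 0" | "t < 0" using False by linarith
  then show ?thesis
  proof cases
    case 1
    then obtain z where "a < z" "z < a + t" "f (a + t) - f a = (a + t - a) * f' z"
      using MVT2[of a "a + t" f f'] deriv by (force simp: abs_if)
    then show ?thesis using 1 by (intro exI[of _ z]) (auto simp: fwd_diff_def)
  next
    case 2
    then obtain z where "a + t < z" "z < a" "f a - f (a + t) = (a - (a + t)) * f' z"
      using MVT2[of "a + t" a f f'] deriv by (force simp: abs_if)
    then show ?thesis using 2 by (intro exI[of _ z]) (auto simp: fwd_diff_def)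
  qed
qed

lemma has_real_derivative_fwd_diff:
  assumes "(f has_real_derivative D) (at u)" and "(f has_real_derivative D') (at (u + t))"
  shows "(fwd_diff t f has_real_derivative D' - D) (at u)"
  using assms unfolding DERIV_shift fwd_diff_def by (rule DERIV_diff[rotated])

text \<open>Since \<open>\<Delta>\<^sub>t\<close> commutes with differentiation, induction applied to \<open>\<Delta>\<^sub>t f\<^sub>0, \<Delta>\<^sub>t f\<^sub>1, \<dots>\<close> leaves a
single difference \<open>\<Delta>\<^sub>t f\<^sub>m\<close>, which the ordinary mean value theorem turns into a value of
\<open>f\<^sub>m\<^sub>+\<^sub>1\<close>.\<close>

lemma fwd_diff_funpow_mean_value:
  fixes f :: "nat \<Rightarrow> real \<Rightarrow> real"
  assumes "\<And>j u. j < m \<Longrightarrow> \<bar>u\<bar> < r \<Longrightarrow> (f j has_real_derivative f (Suc j) u) (at u)"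
    and "\<bar>a\<bar> + real m * \<bar>t\<bar> < r"
  shows "\<exists>\<xi>. \<bar>\<xi> - a\<bar> \<le> real m * \<bar>t\<bar> \<and> (fwd_diff t ^^ m) (f 0) a = t ^ m * f m \<xi>"
  using assms
proof (induction m arbitrary: f r)
  case 0
  then show ?case by (intro exI[of _ a]) simp
next
  case (Suc m)
  define g where "g = (\<lambda>j. fwd_diff t (f j))"
  have g: "(g j has_real_derivative g (Suc j) u) (at u)" if "j < m" "\<bar>u\<bar> < r - \<bar>t\<bar>" for j u
    unfolding g_def fwd_diff_def[of _ "f (Suc j)"]
    using that by (intro has_real_derivative_fwd_diff Suc.prems) auto
  have "\<bar>a\<bar> + real m * \<bar>t\<bar> < r - \<bar>t\<bar>"
    using Suc.prems(2) by (simp add: algebra_simps)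
  from Suc.IH[of "r - \<bar>t\<bar>" g, OF g this] obtain \<xi> where
    \<xi>: "\<bar>\<xi> - a\<bar> \<le> real m * \<bar>t\<bar>" "(fwd_diff t ^^ m) (g 0) a = t ^ m * g m \<xi>"
    by blast
  have "\<exists>\<zeta>. \<bar>\<zeta> - \<xi>\<bar> \<le> \<bar>t\<bar> \<and> fwd_diff t (f m) \<xi> = t * f (Suc m) \<zeta>"
  proof (rule fwd_diff_mean_value)
    fix u assume "\<bar>u - \<xi>\<bar> \<le> \<bar>t\<bar>"
    then have "\<bar>u\<bar> < r"
      using \<xi>(1) Suc.prems(2) by (simp add: algebra_simps)
    then show "(f m has_real_derivative f (Suc m) u) (at u)"
      by (intro Suc.prems) auto
  qed
  then obtain \<zeta> where \<zeta>: "\<bar>\<zeta> - \<xi>\<bar> \<le> \<bar>t\<bar>" "fwd_diff t (f m) \<xi> = t * f (Suc m) \<zeta>"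
    by blast
  have "(fwd_diff t ^^ Suc m) (f 0) a = (fwd_diff t ^^ m) (g 0) a"
    by (simp add: funpow_swap1 g_def)
  also have "\<dots> = t ^ Suc m * f (Suc m) \<zeta>"
    using \<xi>(2) \<zeta>(2) by (simp add: g_def)
  finally show ?case
    using \<xi>(1) \<zeta>(1) by (intro exI[of _ \<zeta>]) (auto simp: algebra_simps)
qed

text \<open>Stopping one application of the mean value theorem short leaves a first difference of \<open>f\<^sub>m\<close>, to
which differentiability at a single point can be applied.\<close>

lemma fwd_diff_funpow_mean_value_Suc:
  fixes f :: "nat \<Rightarrow> real \<Rightarrow> real"
  assumes deriv: "\<And>j u. j < m \<Longrightarrow> \<bar>u\<bar> < r \<Longrightarrow> (f j has_real_derivative f (Suc j) u) (at u)"
    and bound: "\<bar>a\<bar> + real (Suc m) * \<bar>t\<bar> < r"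
  shows "\<exists>\<xi>. \<bar>\<xi> - a\<bar> \<le> real m * \<bar>t\<bar> \<and>
    (fwd_diff t ^^ Suc m) (f 0) a = t ^ m * fwd_diff t (f m) \<xi>"
proof -
  have g: "(fwd_diff t (f j) has_real_derivative fwd_diff t (f (Suc j)) u) (at u)"
    if "j < m" "\<bar>u\<bar> < r - \<bar>t\<bar>" for j u
    unfolding fwd_diff_def[of _ "f (Suc j)"]
    using that by (intro has_real_derivative_fwd_diff deriv) auto
  have "\<bar>a\<bar> + real m * \<bar>t\<bar> < r - \<bar>t\<bar>"
    using bound by (simp add: algebra_simps)
  from fwd_diff_funpow_mean_value[of m "r - \<bar>t\<bar>" "\<lambda>j. fwd_diff t (f j)", OF g this]
  show ?thesis by (simp add: funpow_swap1)
qed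

text \<open>What remains after \<open>fwd_diff_funpow_mean_value_Suc\<close> is a first difference of \<open>f\<^sub>m\<^sub>-\<^sub>1\<close> between two
points at distance \<open>O(t)\<close> from \<open>0\<close>, so the limit follows from differentiability of \<open>f\<^sub>m\<^sub>-\<^sub>1\<close> at
\<open>0\<close>. Continuity of \<open>f\<^sub>m\<close> cannot be used instead: in the application to \<open>m = 2\<close> the mixed
derivative \<open>\<partial>\<^sup>2\<^sup>,\<^sup>2 k\<close>, but not \<open>\<partial>\<^sup>0\<^sup>,\<^sup>2 k\<close>, is assumed to be continuous.\<close>

lemma fwd_diff_funpow_quotient_tendsto:
  fixes f :: "nat \<Rightarrow> real \<Rightarrow> real"
  assumes "r > 0"
    and deriv: "\<And>j u. j < m \<Longrightarrow> \<bar>u\<bar> < r \<Longrightarrow> (f j has_real_derivative f (Suc j) u) (at u)"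
  shows "((\<lambda>t. (fwd_diff t ^^ m) (f 0) 0 / t ^ m) \<longlongrightarrow> f m 0) (at 0)"
proof (cases m)
  case 0
  then show ?thesis by simp
next
  case (Suc n)
  define L where "L = f m 0"
  have "(f n has_real_derivative L) (at 0)"
    using deriv[of n 0] Suc \<open>r > 0\<close> by (simp add: L_def)
  then have deriv_n: "(f n has_derivative (*) L) (at 0)"
    by (simp add: has_field_derivative_def)
  show ?thesis
    unfolding L_def[symmetric]
  proof (rule tendstoI)
    fix e :: real assume "e > 0"
    \<comment> \<open>The two points \<open>\<xi>\<close> and \<open>\<xi> + t\<close> below are at distance at most \<open>n \<bar>t\<bar>\<close> and
      \<open>(n + 1) \<bar>t\<bar>\<close> from \<open>0\<close>; \<open>c\<close> makes their total error \<open>e / 2 * \<bar>t\<bar>\<close>.\<close>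
    define c where "c = e / (2 * (2 * real n + 1))"
    have "c > 0" using \<open>e > 0\<close> by (simp add: c_def)
    with deriv_n obtain d where "d > 0"
      and d: "\<And>y. \<bar>y\<bar> < d \<Longrightarrow> \<bar>f n y - f n 0 - L * y\<bar> \<le> c * \<bar>y\<bar>"
      unfolding has_derivative_at_alt by auto
    define \<delta> where "\<delta> = min d r / (2 * real m)"
    have "\<delta> > 0" using \<open>d > 0\<close> \<open>r > 0\<close> Suc by (simp add: \<delta>_def)
    have "dist ((fwd_diff t ^^ m) (f 0) 0 / t ^ m) L < e" if t: "t \<noteq> 0" "\<bar>t\<bar> < \<delta>" for t
    proof -
      have mt: "real m * \<bar>t\<bar> < min d r"
        using t \<open>d > 0\<close> \<open>r > 0\<close> Suc by (simp add: \<delta>_def field_simps)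
      have "\<exists>\<xi>. \<bar>\<xi> - 0\<bar> \<le> real n * \<bar>t\<bar> \<and>
          (fwd_diff t ^^ Suc n) (f 0) 0 = t ^ n * fwd_diff t (f n) \<xi>"
        using mt Suc by (intro fwd_diff_funpow_mean_value_Suc[of n r]) (auto intro!: deriv)
      then obtain \<xi> where \<xi>: "\<bar>\<xi>\<bar> \<le> real n * \<bar>t\<bar>"
          "(fwd_diff t ^^ m) (f 0) 0 = t ^ n * fwd_diff t (f n) \<xi>"
        using Suc by auto
      have \<xi>t: "\<bar>\<xi> + t\<bar> \<le> real m * \<bar>t\<bar>" using \<xi>(1) Suc by (simp add: algebra_simps)
      have "real n * \<bar>t\<bar> \<le> real m * \<bar>t\<bar>" using Suc by (simp add: mult_right_mono)
      then have "\<bar>\<xi>\<bar> < d" "\<bar>\<xi> + t\<bar> < d" using \<xi>(1) \<xi>t mt by linarith+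
      then have "\<bar>f n \<xi> - f n 0 - L * \<xi>\<bar> \<le> c * \<bar>\<xi>\<bar>"
          "\<bar>f n (\<xi> + t) - f n 0 - L * (\<xi> + t)\<bar> \<le> c * \<bar>\<xi> + t\<bar>"
        by (auto intro: d)
      moreover have "c * \<bar>\<xi>\<bar> \<le> c * (real n * \<bar>t\<bar>)" "c * \<bar>\<xi> + t\<bar> \<le> c * (real m * \<bar>t\<bar>)"
        using \<xi>(1) \<xi>t \<open>c > 0\<close> by (auto intro: mult_left_mono)
      ultimately have "\<bar>fwd_diff t (f n) \<xi> - L * t\<bar> \<le> c * (real n * \<bar>t\<bar>) + c * (real m * \<bar>t\<bar>)"
        unfolding fwd_diff_def distrib_left by linarith
      also have "\<dots> = e / 2 * \<bar>t\<bar>"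
      proof -
        have "e / (2 * k) * k = e / 2" if "k > 0" for k
          using that by simp
        from this[of "2 * real n + 1"] have "c * (2 * real n + 1) = e / 2"
          unfolding c_def by linarith
        moreover have "c * (real n * \<bar>t\<bar>) + c * (real m * \<bar>t\<bar>) = c * (2 * real n + 1) * \<bar>t\<bar>"
          using Suc by (simp add: algebra_simps)
        ultimately show ?thesis
          by (simp only:)
      qed
      finally have "\<bar>fwd_diff t (f n) \<xi> - L * t\<bar> / \<bar>t\<bar> \<le> e / 2"
        using t by (simp add: field_simps)
      moreover have "(fwd_diff t ^^ m) (f 0) 0 / t ^ m - L = (fwd_diff t (f n) \<xi> - L * t) / t"
        using \<xi>(2) t Suc by (simp add: field_simps)
      then have "dist ((fwd_diff t ^^ m) (f 0) 0 / t ^ m) L = \<bar>fwd_diff t (f n) \<xi> - L * t\<bar> / \<bar>t\<bar>"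
        by (simp add: dist_real_def)
      ultimately show ?thesis
        using \<open>e > 0\<close> by linarith
    qed
    then show "\<forall>\<^sub>F t in at 0. dist ((fwd_diff t ^^ m) (f 0) 0 / t ^ m) L < e"
      using \<open>\<delta> > 0\<close> unfolding eventually_at by (auto intro!: exI[of _ \<delta>])
  qed
qed

lemma has_real_derivative_fwd_diff_funpow:
  fixes h :: "real \<Rightarrow> real \<Rightarrow> real"
  assumes "\<And>u. \<bar>u - a\<bar> \<le> real m * \<bar>t\<bar> \<Longrightarrow> ((\<lambda>v. h u v) has_real_derivative h' u) (at v)"
  shows "((\<lambda>v. (fwd_diff t ^^ m) (\<lambda>u. h u v) a) has_real_derivative (fwd_diff t ^^ m) h' a) (at v)"
  using assms
proof (induction m arbitrary: a)
  case (Suc m)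
  have 1: "((\<lambda>v. (fwd_diff t ^^ m) (\<lambda>u. h u v) (a + t)) has_real_derivative
      (fwd_diff t ^^ m) h' (a + t)) (at v)"
    by (rule Suc.IH, rule Suc.prems) (auto simp: algebra_simps)
  have 2: "((\<lambda>v. (fwd_diff t ^^ m) (\<lambda>u. h u v) a) has_real_derivative
      (fwd_diff t ^^ m) h' a) (at v)"
    by (rule Suc.IH, rule Suc.prems) (auto simp: algebra_simps)
  show ?case
    using DERIV_diff[OF 1 2] by (simp add: fwd_diff_def[of t "(fwd_diff t ^^ m) _"])
qed simp

text \<open>The derivatives \<open>F\<close> in the second variable come first, those in the first variable, \<open>G\<close>, are
taken of \<open>F m\<close>; so a single order of partial differentiation is enough.\<close>

lemma fwd_diff_funpow_double_mean_value:
  fixes F G :: "nat \<Rightarrow> real \<Rightarrow> real \<Rightarrow> real"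
  assumes F: "\<And>j u v. j < m \<Longrightarrow> \<bar>u\<bar> < r \<Longrightarrow> \<bar>v\<bar> < r \<Longrightarrow>
      ((\<lambda>v. F j u v) has_real_derivative F (Suc j) u v) (at v)"
    and G: "\<And>j u v. j < m \<Longrightarrow> \<bar>u\<bar> < r \<Longrightarrow> \<bar>v\<bar> < r \<Longrightarrow>
      ((\<lambda>u. G j u v) has_real_derivative G (Suc j) u v) (at u)"
    and FG: "G 0 = F m"
    and t: "real m * \<bar>t\<bar> < r" and s: "real m * \<bar>s\<bar> < r"
  shows "\<exists>\<xi> \<eta>. \<bar>\<xi>\<bar> \<le> real m * \<bar>t\<bar> \<and> \<bar>\<eta>\<bar> \<le> real m * \<bar>s\<bar> \<and>
    (fwd_diff s ^^ m) (\<lambda>v. (fwd_diff t ^^ m) (\<lambda>u. F 0 u v) 0) 0 = t ^ m * s ^ m * G m \<xi> \<eta>"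
proof -
  have "\<exists>\<eta>. \<bar>\<eta> - 0\<bar> \<le> real m * \<bar>s\<bar> \<and>
      (fwd_diff s ^^ m) (\<lambda>v. (fwd_diff t ^^ m) (\<lambda>u. F 0 u v) 0) 0 =
      s ^ m * (fwd_diff t ^^ m) (\<lambda>u. F m u \<eta>) 0"
  proof (rule fwd_diff_funpow_mean_value[of m r "\<lambda>j v. (fwd_diff t ^^ m) (\<lambda>u. F j u v) 0"])
    fix j v assume "j < m" "\<bar>v\<bar> < r"
    then show "((\<lambda>v. (fwd_diff t ^^ m) (\<lambda>u. F j u v) 0) has_real_derivative
        (fwd_diff t ^^ m) (\<lambda>u. F (Suc j) u v) 0) (at v)"
      using t by (intro has_real_derivative_fwd_diff_funpow F) auto
  qed (use s in auto)
  then obtain \<eta> where \<eta>: "\<bar>\<eta>\<bar> \<le> real m * \<bar>s\<bar>"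
      "(fwd_diff s ^^ m) (\<lambda>v. (fwd_diff t ^^ m) (\<lambda>u. F 0 u v) 0) 0 =
       s ^ m * (fwd_diff t ^^ m) (\<lambda>u. G 0 u \<eta>) 0"
    using FG by auto
  have "\<exists>\<xi>. \<bar>\<xi> - 0\<bar> \<le> real m * \<bar>t\<bar> \<and>
      (fwd_diff t ^^ m) (\<lambda>u. G 0 u \<eta>) 0 = t ^ m * G m \<xi> \<eta>"
    using \<eta>(1) s t by (intro fwd_diff_funpow_mean_value[of m r "\<lambda>j u. G j u \<eta>"] G) auto
  then obtain \<xi> where "\<bar>\<xi>\<bar> \<le> real m * \<bar>t\<bar>" "(fwd_diff t ^^ m) (\<lambda>u. G 0 u \<eta>) 0 = t ^ m * G m \<xi> \<eta>"
    by auto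
  with \<eta> show ?thesis
    by (intro exI[of _ \<xi>] exI[of _ \<eta>]) simp
qed

section \<open>Partial derivatives along lines\<close>

lemma has_real_derivative_pd:
  fixes f :: "'a::real_normed_vector \<Rightarrow> real"
  assumes "pd_exists v f (x + u *\<^sub>R v)"
  shows "((\<lambda>t. f (x + t *\<^sub>R v)) has_real_derivative pd v f (x + u *\<^sub>R v)) (at u)"
proof -
  have "((\<lambda>t. f (x + u *\<^sub>R v + t *\<^sub>R v)) has_real_derivative pd v f (x + u *\<^sub>R v)) (at 0)"
    using assms unfolding pd_exists_def pd_def
    by (simp add: has_real_derivative_iff_has_vector_derivative vector_derivative_works)
  then show ?thesis
    using DERIV_shift[of "\<lambda>t. f (x + t *\<^sub>R v)" _ 0 u] by (simp add: algebra_simps)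
qed

lemma iter_pd_exists_append:
  "iter_pd_exists (vs @ ws) f U \<longleftrightarrow> iter_pd_exists ws f U \<and> iter_pd_exists vs (iter_pd ws f) U"
  and iter_pd_append: "iter_pd (vs @ ws) f = iter_pd vs (iter_pd ws f)"
proof -
  show *: "iter_pd (vs @ ws) f = iter_pd vs (iter_pd ws f)" for vs
    by (induction vs) auto
  show "iter_pd_exists (vs @ ws) f U \<longleftrightarrow> iter_pd_exists ws f U \<and> iter_pd_exists vs (iter_pd ws f) U"
    by (induction vs) (auto simp: *)
qed

lemma pd_existsD_replicate:
  assumes "iter_pd_exists (replicate m v) f U" and "j < m" and "x \<in> U"
  shows "pd_exists v (iter_pd (replicate j v) f) x"
  using assms
proof (induction m)
  case (Suc m)
  then show ?case by (cases "j = m") auto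
qed simp

lemma eventually_line_in_open:
  fixes x v :: "'a::real_normed_vector"
  assumes "open U" and "x \<in> U"
  shows "\<forall>\<^sub>F t in nhds 0. x + t *\<^sub>R v \<in> U"
proof (rule topological_tendstoD[OF _ \<open>open U\<close>])
  show "((\<lambda>t. x + t *\<^sub>R v) \<longlongrightarrow> x) (nhds 0)"
    by (auto intro!: tendsto_eq_intros filterlim_ident)
qed (use assms in simp)

lemma pd_cong_open:
  assumes "open U" and "x \<in> U" and "\<And>y. y \<in> U \<Longrightarrow> f y = g y"
  shows "pd v f x = pd v g x"
proof -
  have "\<forall>\<^sub>F t in nhds 0. x + t *\<^sub>R v \<in> U"
    using assms by (intro eventually_line_in_open)
  then have "\<forall>\<^sub>F t in nhds 0. f (x + t *\<^sub>R v) = g (x + t *\<^sub>R v)"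
    by eventually_elim (simp add: assms)
  then show ?thesis
    unfolding pd_def by (intro vector_derivative_cong_eq) auto
qed

lemma iter_pd_cong_open:
  assumes "open U" and "\<And>y. y \<in> U \<Longrightarrow> f y = g y" and "x \<in> U"
  shows "iter_pd vs f x = iter_pd vs g x"
  using \<open>x \<in> U\<close>
proof (induction vs arbitrary: x)
  case (Cons v vs)
  then show ?case by (auto intro: pd_cong_open[OF \<open>open U\<close>])
qed (use assms in simp)

text \<open>Both sides are the same iterated \<open>vector_derivative\<close> along a line, whether or not the
derivatives exist.\<close>

lemma iter_pd_swap_arguments:
  "iter_pd (replicate m (v, 0)) f (x, y) = iter_pd (replicate m (0, v)) (f \<circ> prod.swap) (y, x)"
proof (induction m arbitrary: x y)
  case (Suc m)
  then show ?case by (simp add: pd_def)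
qed simp

section \<open>Derivatives of the feature map of a smooth kernel\<close>

text \<open>By \<open>\<parallel>S\<^sub>s - S\<^sub>t\<parallel>\<^sup>2 = \<langle>S\<^sub>s, S\<^sub>s\<rangle> - 2\<langle>S\<^sub>s, S\<^sub>t\<rangle> + \<langle>S\<^sub>t, S\<^sub>t\<rangle>\<close>, where the limits of the three terms cancel, the family is Cauchy.
It produces a limit in \<open>\<H>\<close> without a candidate for it.\<close>

lemma inner_tendsto_imp_convergent:
  fixes S :: "'a \<Rightarrow> 'h::{real_inner,complete_space}"
  assumes "F \<noteq> bot" and lim: "((\<lambda>(s, t). S s \<bullet> S t) \<longlongrightarrow> L) (F \<times>\<^sub>F F)"
  shows "\<exists>D. (S \<longlongrightarrow> D) F"
proof -
  have "cauchy_filter (filtermap S F)"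
    unfolding cauchy_filter_metric_filtermap
  proof (intro allI impI)
    fix e :: real assume "e > 0"
    define c where "c = e\<^sup>2 / 8"
    have "c > 0" using \<open>e > 0\<close> by (simp add: c_def)
    then have "\<forall>\<^sub>F (s, t) in F \<times>\<^sub>F F. \<bar>S s \<bullet> S t - L\<bar> < c"
      using tendstoD[OF lim, of c] by (simp add: dist_real_def case_prod_unfold)
    then obtain P where P: "eventually P F"
        "\<And>s t. P s \<Longrightarrow> P t \<Longrightarrow> \<bar>S s \<bullet> S t - L\<bar> < c"
      unfolding eventually_prod_same by auto
    have "dist (S s) (S t) < e" if "P s" "P t" for s t
    proof -
      have "\<bar>S s \<bullet> S s - L\<bar> < c" "\<bar>S s \<bullet> S t - L\<bar> < c" "\<bar>S t \<bullet> S t - L\<bar> < c"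
        using that P(2) by blast+
      moreover have "(norm (S s - S t))\<^sup>2 = S s \<bullet> S s - 2 * (S s \<bullet> S t) + S t \<bullet> S t"
        by (simp add: power2_norm_eq_inner inner_diff_left inner_diff_right inner_commute)
      ultimately have "(norm (S s - S t))\<^sup>2 < 4 * c + c"
        using \<open>c > 0\<close> by linarith
      also have "\<dots> \<le> e\<^sup>2" by (simp add: c_def)
      finally show ?thesis
        using \<open>e > 0\<close> by (simp add: dist_norm power2_less_imp_less)
    qed
    with P(1) show "\<exists>P. eventually P F \<and> (\<forall>x y. P x \<and> P y \<longrightarrow> dist (S x) (S y) < e)"
      by blast
  qed
  then have "\<exists>D. filtermap S F \<le> nhds D"
    using \<open>F \<noteq> bot\<close>
    by (intro cauchy_filter_complete_converges[of _ UNIV]) (auto simp: complete_UNIV filtermap_bot_iff)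
  then show ?thesis
    by (simp add: filterlim_def)
qed

text \<open>Inner products of the \<open>m\<close>-th difference quotients of the feature map are values of the mixed
derivative of order \<open>(m, m)\<close> of the kernel near \<open>(x, x)\<close>, which makes the quotients Cauchy. The second conclusion identifies
the limit through its inner products with features.\<close>

lemma feature_map_derivative_exists:
  fixes \<Phi> :: "'a::real_normed_vector \<Rightarrow> 'h::{real_inner,complete_space}"
  assumes "open \<Omega>" and "x \<in> \<Omega>"
    and k: "\<And>x y. x \<in> \<Omega> \<Longrightarrow> y \<in> \<Omega> \<Longrightarrow> k (x, y) = \<Phi> x \<bullet> \<Phi> y"
    and ex: "iter_pd_exists (replicate m (v, 0) @ replicate m (0, v)) k (\<Omega> \<times> \<Omega>)"
    and cont: "continuous_on (\<Omega> \<times> \<Omega>) (iter_pd (replicate m (v, 0) @ replicate m (0, v)) k)"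
  obtains D where
    "((\<lambda>t. (1 / t ^ m) *\<^sub>R (fwd_diff t ^^ m) (\<lambda>u. \<Phi> (x + u *\<^sub>R v)) 0) \<longlongrightarrow> D) (at 0)"
    "\<And>y. y \<in> \<Omega> \<Longrightarrow> D \<bullet> \<Phi> y = iter_pd (replicate m (0, v)) k (y, x)"
proof -
  define S where "S = (\<lambda>t. (1 / t ^ m) *\<^sub>R (fwd_diff t ^^ m) (\<lambda>u. \<Phi> (x + u *\<^sub>R v)) 0)"
  define F where "F = (\<lambda>j u w. iter_pd (replicate j (0, v)) k (x + u *\<^sub>R v, x + w *\<^sub>R v))"
  define G where "G = (\<lambda>j u w.
    iter_pd (replicate j (v, 0)) (iter_pd (replicate m (0, v)) k) (x + u *\<^sub>R v, x + w *\<^sub>R v))"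
  obtain r where "r > 0" and r: "\<And>u. \<bar>u\<bar> < r \<Longrightarrow> x + u *\<^sub>R v \<in> \<Omega>"
    using eventually_line_in_open[OF \<open>open \<Omega>\<close> \<open>x \<in> \<Omega>\<close>, of v]
    by (auto simp: eventually_nhds_metric)
  have pd2: "((\<lambda>t. iter_pd (replicate j (0, v)) k (y, x + t *\<^sub>R v)) has_real_derivative
      iter_pd (replicate (Suc j) (0, v)) k (y, x + u *\<^sub>R v)) (at u)"
    if "j < m" "y \<in> \<Omega>" "\<bar>u\<bar> < r" for j y u
    using has_real_derivative_pd[of "(0, v)" "iter_pd (replicate j (0, v)) k" "(y, x)" u]
      pd_existsD_replicate[of m "(0, v)" k "\<Omega> \<times> \<Omega>" j "(y, x + u *\<^sub>R v)"] that r ex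
    by (simp add: iter_pd_exists_append)
  have pd1: "((\<lambda>u. G j u w) has_real_derivative G (Suc j) u w) (at u)"
    if "j < m" "\<bar>u\<bar> < r" "\<bar>w\<bar> < r" for j u w
    using has_real_derivative_pd[of "(v, 0)"
        "iter_pd (replicate j (v, 0)) (iter_pd (replicate m (0, v)) k)" "(x, x + w *\<^sub>R v)" u]
      pd_existsD_replicate[of m "(v, 0)" "iter_pd (replicate m (0, v)) k" "\<Omega> \<times> \<Omega>" j
        "(x + u *\<^sub>R v, x + w *\<^sub>R v)"] that r ex
    by (simp add: iter_pd_exists_append G_def)
  have S_inner: "\<exists>\<xi> \<eta>. \<bar>\<xi>\<bar> \<le> real m * \<bar>t\<bar> \<and> \<bar>\<eta>\<bar> \<le> real m * \<bar>s\<bar> \<and> S t \<bullet> S s = G m \<xi> \<eta>"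
    if "t \<noteq> 0" "s \<noteq> 0" and t: "real m * \<bar>t\<bar> < r" and s: "real m * \<bar>s\<bar> < r" for t s
  proof -
    obtain \<xi> \<eta> where \<xi>\<eta>: "\<bar>\<xi>\<bar> \<le> real m * \<bar>t\<bar>" "\<bar>\<eta>\<bar> \<le> real m * \<bar>s\<bar>"
      and diff: "(fwd_diff s ^^ m) (\<lambda>w. (fwd_diff t ^^ m) (\<lambda>u. F 0 u w) 0) 0 = t ^ m * s ^ m * G m \<xi> \<eta>"
      using fwd_diff_funpow_double_mean_value[of m r F G t s] t s pd2 pd1 r
      by (auto simp: F_def G_def fun_eq_iff)
    have inner: "(fwd_diff s ^^ m) (\<lambda>w. (fwd_diff t ^^ m) (\<lambda>u. F 0 u w) 0) 0 =
        (fwd_diff t ^^ m) (\<lambda>u. \<Phi> (x + u *\<^sub>R v)) 0 \<bullet> (fwd_diff s ^^ m) (\<lambda>u. \<Phi> (x + u *\<^sub>R v)) 0"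
      unfolding inner_fwd_diff_funpow_both
      using t s r k by (intro fwd_diff_funpow_cong) (simp add: F_def)
    have "S t \<bullet> S s = t ^ m * s ^ m * G m \<xi> \<eta> / (t ^ m * s ^ m)"
      unfolding diff[symmetric] inner by (simp add: S_def mult.commute)
    then have "S t \<bullet> S s = G m \<xi> \<eta>"
      using \<open>t \<noteq> 0\<close> \<open>s \<noteq> 0\<close> by simp
    with \<xi>\<eta> show ?thesis
      by blast
  qed
  have "((\<lambda>(s, t). S s \<bullet> S t) \<longlongrightarrow> G m 0 0) (at 0 \<times>\<^sub>F at 0)"
  proof (rule tendstoI)
    fix e :: real assume "e > 0"
    define g where "g = iter_pd (replicate m (v, 0) @ replicate m (0, v)) k"
    define line where "line = (\<lambda>p. (x + fst p *\<^sub>R v, x + snd p *\<^sub>R v))"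
    have "isCont g (x, x)"
      using cont \<open>open \<Omega>\<close> \<open>x \<in> \<Omega>\<close>
      by (auto simp: g_def continuous_on_eq_continuous_at open_Times)
    then have "isCont g (line (0, 0))"
      by (simp add: line_def)
    moreover have "isCont line (0, 0)"
      unfolding line_def by (intro continuous_intros)
    moreover have "(\<lambda>p. G m (fst p) (snd p)) = (\<lambda>p. g (line p))"
      by (simp add: G_def g_def line_def iter_pd_append)
    ultimately have "isCont (\<lambda>p. G m (fst p) (snd p)) (0, 0)"
      using isCont_o2[of "(0, 0)" line g] by simp
    then obtain d where "d > 0" and
      d: "\<And>p. dist p (0, 0) < d \<Longrightarrow> dist (G m (fst p) (snd p)) (G m 0 0) < e"
      using \<open>e > 0\<close> unfolding continuous_at_eps_delta by (metis fst_conv snd_conv)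
    \<comment> \<open>Both mean value points then lie within \<open>d / 2\<close> of \<open>0\<close>; the denominator is
      \<open>m + 1\<close> so that \<open>m = 0\<close> is covered.\<close>
    define \<delta> where "\<delta> = min (d / 2) r / (real m + 1)"
    have "\<delta> > 0" using \<open>d > 0\<close> \<open>r > 0\<close> by (simp add: \<delta>_def)
    have small: "real m * \<bar>t\<bar> < min (d / 2) r" if "\<bar>t\<bar> < \<delta>" for t
    proof -
      have "real m * \<bar>t\<bar> \<le> (real m + 1) * \<bar>t\<bar>" by (simp add: algebra_simps)
      also have "\<dots> < min (d / 2) r"
        using that by (simp add: \<delta>_def pos_less_divide_eq mult.commute)
      finally show ?thesis .
    qed
    have "dist (S s \<bullet> S t) (G m 0 0) < e"
      if st: "s \<noteq> 0" "\<bar>s\<bar> < \<delta>" "t \<noteq> 0" "\<bar>t\<bar> < \<delta>" for s t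
    proof -
      obtain \<xi> \<eta> where "\<bar>\<xi>\<bar> \<le> real m * \<bar>s\<bar>" "\<bar>\<eta>\<bar> \<le> real m * \<bar>t\<bar>" and eq: "S s \<bullet> S t = G m \<xi> \<eta>"
        using S_inner[of s t] small[of s] small[of t] st by auto
      then have "\<bar>\<xi>\<bar> + \<bar>\<eta>\<bar> < d"
        using small[of s] small[of t] st by linarith
      then have "dist (\<xi>, \<eta>) (0, 0) < d"
        using norm_Pair_le[of \<xi> \<eta>] by (simp add: dist_norm)
      then show ?thesis using d eq by fastforce
    qed
    moreover have "\<forall>\<^sub>F t in at 0. t \<noteq> 0 \<and> \<bar>t\<bar> < \<delta>"
      using \<open>\<delta> > 0\<close> by (auto simp: eventually_at intro!: exI[of _ \<delta>])
    ultimately show "\<forall>\<^sub>F p in at 0 \<times>\<^sub>F at 0. dist (case p of (s, t) \<Rightarrow> S s \<bullet> S t) (G m 0 0) < e"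
      unfolding eventually_prod_same
      by (intro exI[of _ "\<lambda>t. t \<noteq> 0 \<and> \<bar>t\<bar> < \<delta>"]) auto
  qed
  then obtain D where D: "(S \<longlongrightarrow> D) (at 0)"
    using inner_tendsto_imp_convergent[of "at 0" S] by auto
  have "D \<bullet> \<Phi> y = iter_pd (replicate m (0, v)) k (y, x)" if "y \<in> \<Omega>" for y
  proof (rule tendsto_unique[of "at (0::real)"])
    show "((\<lambda>t. S t \<bullet> \<Phi> y) \<longlongrightarrow> D \<bullet> \<Phi> y) (at 0)"
      by (intro tendsto_intros D)
    define f where "f = (\<lambda>j u. iter_pd (replicate j (0, v)) k (y, x + u *\<^sub>R v))"
    have "((\<lambda>t. (fwd_diff t ^^ m) (f 0) 0 / t ^ m) \<longlongrightarrow> f m 0) (at 0)"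
      using pd2 that by (intro fwd_diff_funpow_quotient_tendsto[OF \<open>r > 0\<close>]) (simp add: f_def)
    moreover have "\<forall>\<^sub>F t in at 0. (fwd_diff t ^^ m) (f 0) 0 / t ^ m = S t \<bullet> \<Phi> y"
      unfolding eventually_at
    proof (intro exI[of _ "r / (real m + 1)"] conjI ballI impI)
      fix t :: real assume "t \<noteq> 0 \<and> dist t 0 < r / (real m + 1)"
      then have "(real m + 1) * \<bar>t\<bar> < r"
        by (simp add: pos_less_divide_eq mult.commute)
      moreover have "real m * \<bar>t\<bar> \<le> (real m + 1) * \<bar>t\<bar>"
        by (simp add: algebra_simps)
      ultimately have "(fwd_diff t ^^ m) (f 0) 0 = (fwd_diff t ^^ m) (\<lambda>u. \<Phi> (x + u *\<^sub>R v) \<bullet> \<Phi> y) 0"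
        using r k that by (intro fwd_diff_funpow_cong) (simp add: f_def inner_commute)
      then show "(fwd_diff t ^^ m) (f 0) 0 / t ^ m = S t \<bullet> \<Phi> y"
        by (simp add: S_def inner_fwd_diff_funpow)
    qed (use \<open>r > 0\<close> in simp)
    ultimately show "((\<lambda>t. S t \<bullet> \<Phi> y) \<longlongrightarrow> iter_pd (replicate m (0, v)) k (y, x)) (at 0)"
      by (auto simp: f_def elim: Lim_transform_eventually)
  qed simp
  with D show thesis
    unfolding S_def by (rule that)
qed

locale rkhs_on_open = rkhs \<Omega> fn k
  for \<Omega> :: "'a::real_normed_vector set"
    and fn :: "'h::{real_inner,complete_space} \<Rightarrow> 'a \<Rightarrow> real"
    and k :: "'a \<times> 'a \<Rightarrow> real" +
  assumes open_domain: "open \<Omega>"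
begin

text \<open>The section \<open>k(x, \<cdot>)\<close>, introduced as the Riesz representer of evaluation at \<open>x\<close>.\<close>

definition feature :: "'a \<Rightarrow> 'h" where
  "feature x = (SOME u. \<forall>f. fn f x = f \<bullet> u)"

lemma fn_eq_inner_feature: "x \<in> \<Omega> \<Longrightarrow> fn f x = f \<bullet> feature x"
  unfolding feature_def using someI_ex[of "\<lambda>u. \<forall>f. fn f x = f \<bullet> u"] reproducing[of x] by blast

lemma kernel_eq_inner_feature:
  assumes "x \<in> \<Omega>" "y \<in> \<Omega>"
  shows "k (x, y) = feature x \<bullet> feature y"
proof -
  obtain u where u: "\<And>y. y \<in> \<Omega> \<Longrightarrow> fn u y = k (x, y)" "\<And>f. fn f x = f \<bullet> u"
    using reproducing[OF \<open>x \<in> \<Omega>\<close>] by blast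
  have "feature x = u"
    using u(2) fn_eq_inner_feature[OF \<open>x \<in> \<Omega>\<close>]
    by (metis inner_commute vector_eq_ldot)
  then show ?thesis
    using u(1) fn_eq_inner_feature assms by metis
qed

lemma rkhs_elem_eqI:
  assumes "\<And>y. y \<in> \<Omega> \<Longrightarrow> fn u y = g y"
  shows "rkhs_elem \<Omega> fn g = u"
  unfolding rkhs_elem_def using assms by (intro the_equality) (auto intro: fn_inject)

text \<open>The condition on \<open>\<partial>\<^sup>\<alpha>\<^sup>,\<^sup>\<alpha> k\<close> for the multi-index \<open>\<alpha>\<close> concentrated on one direction with
multiplicity \<open>m\<close>, for an arbitrary direction \<open>v\<close>.\<close>

definition kernel_smooth :: "nat \<Rightarrow> 'a \<Rightarrow> bool" where
  "kernel_smooth m v \<longleftrightarrow>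
     iter_pd_exists (replicate m (v, 0) @ replicate m (0, v)) k (\<Omega> \<times> \<Omega>) \<and>
     continuous_on (\<Omega> \<times> \<Omega>) (iter_pd (replicate m (v, 0) @ replicate m (0, v)) k)"

definition deriv_feature :: "nat \<Rightarrow> 'a \<Rightarrow> 'a \<Rightarrow> 'h" where
  "deriv_feature m v x = rkhs_elem \<Omega> fn (\<lambda>y. iter_pd (replicate m (v, 0)) k (x, y))"

lemma iter_pd_kernel_symmetric:
  assumes "x \<in> \<Omega>" "y \<in> \<Omega>"
  shows "iter_pd (replicate m (v, 0)) k (x, y) = iter_pd (replicate m (0, v)) k (y, x)"
  unfolding iter_pd_swap_arguments
  using assms open_domain
  by (intro iter_pd_cong_open[of "\<Omega> \<times> \<Omega>"])
    (auto simp: open_Times kernel_eq_inner_feature inner_commute)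

text \<open>The limit of the difference quotients of the feature map is an element of the space whose values
are the derivatives of the kernel, so it is the element denoted by \<open>\<partial>\<^sub>1\<^sup>m k(x, \<cdot>)\<close>.\<close>

lemma
  assumes "kernel_smooth m v" and "x \<in> \<Omega>"
  shows in_rkhs_deriv: "in_rkhs \<Omega> fn (\<lambda>y. iter_pd (replicate m (v, 0)) k (x, y))"
    and deriv_feature_tendsto:
      "((\<lambda>t. (1 / t ^ m) *\<^sub>R (fwd_diff t ^^ m) (\<lambda>u. feature (x + u *\<^sub>R v)) 0)
         \<longlongrightarrow> deriv_feature m v x) (at 0)"
    and feature_inner_deriv_feature:
      "y \<in> \<Omega> \<Longrightarrow> feature y \<bullet> deriv_feature m v x = iter_pd (replicate m (0, v)) k (y, x)"
proof -
  obtain D where D: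
    "((\<lambda>t. (1 / t ^ m) *\<^sub>R (fwd_diff t ^^ m) (\<lambda>u. feature (x + u *\<^sub>R v)) 0) \<longlongrightarrow> D) (at 0)"
    "\<And>y. y \<in> \<Omega> \<Longrightarrow> D \<bullet> feature y = iter_pd (replicate m (0, v)) k (y, x)"
    using feature_map_derivative_exists[of \<Omega> x k feature m v] open_domain
      kernel_eq_inner_feature assms unfolding kernel_smooth_def by blast
  have fn_D: "fn D y = iter_pd (replicate m (v, 0)) k (x, y)" if "y \<in> \<Omega>" for y
    using that \<open>x \<in> \<Omega>\<close> D(2) by (simp add: fn_eq_inner_feature iter_pd_kernel_symmetric)
  have eq: "deriv_feature m v x = D"
    unfolding deriv_feature_def by (intro rkhs_elem_eqI fn_D)
  show "in_rkhs \<Omega> fn (\<lambda>y. iter_pd (replicate m (v, 0)) k (x, y))"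
    unfolding in_rkhs_def using fn_D by blast
  show "((\<lambda>t. (1 / t ^ m) *\<^sub>R (fwd_diff t ^^ m) (\<lambda>u. feature (x + u *\<^sub>R v)) 0)
         \<longlongrightarrow> deriv_feature m v x) (at 0)"
    unfolding eq by (rule D(1))
  show "feature y \<bullet> deriv_feature m v x = iter_pd (replicate m (0, v)) k (y, x)" if "y \<in> \<Omega>"
    using that D(2) by (simp add: eq inner_commute)
qed

text \<open>Convergence of the first difference quotients in norm lets the derivative in the first argument be
pulled out of the inner product with any fixed element, here \<open>\<partial>\<^sub>w\<^sup>m k(y, \<cdot>)\<close>, whose pairing with
features is again a derivative of \<open>k\<close>.\<close>

lemma inner_deriv_features:
  assumes "kernel_smooth 1 v" "kernel_smooth m w" and "x \<in> \<Omega>" "y \<in> \<Omega>"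
  shows "deriv_feature 1 v x \<bullet> deriv_feature m w y = iter_pd ((v, 0) # replicate m (0, w)) k (x, y)"
proof -
  let ?E = "deriv_feature m w y"
  have "((\<lambda>t. (1 / t ^ 1) *\<^sub>R (fwd_diff t ^^ 1) (\<lambda>u. feature (x + u *\<^sub>R v)) 0 \<bullet> ?E)
      \<longlongrightarrow> deriv_feature 1 v x \<bullet> ?E) (at 0)"
    by (intro tendsto_intros deriv_feature_tendsto assms)
  then have "((\<lambda>t. feature (x + t *\<^sub>R v) \<bullet> ?E) has_real_derivative deriv_feature 1 v x \<bullet> ?E) (at 0)"
    unfolding DERIV_def by (simp add: fwd_diff_def inner_diff_left)
  then have "deriv_feature 1 v x \<bullet> ?E = pd v (\<lambda>x. feature x \<bullet> ?E) x"
    unfolding pd_def has_real_derivative_iff_has_vector_derivative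
    by (rule vector_derivative_at[symmetric])
  also have "\<dots> = pd v (\<lambda>x. iter_pd (replicate m (0, w)) k (x, y)) x"
    by (intro pd_cong_open[OF open_domain \<open>x \<in> \<Omega>\<close>] feature_inner_deriv_feature assms)
  also have "\<dots> = iter_pd ((v, 0) # replicate m (0, w)) k (x, y)"
    by (simp add: pd_def)
  finally show ?thesis .
qed

end

section \<open>Minimizers of ridge-penalized quadratic functionals\<close>

text \<open>Completing the square: \<open>g\<close> is a zero of the gradient, so only the quadratic part of the
functional in \<open>f - g\<close> remains.\<close>

lemma ridge_functional_at_critical_point:
  fixes e :: "'r::finite \<Rightarrow> 'h::real_inner"
  assumes J: "\<And>f. J f = 1 / 2 * (f \<bullet> (c *\<^sub>R (\<Sum>r\<in>UNIV. (e r \<bullet> f) *\<^sub>R e r))) + f \<bullet> \<xi> + K + lam / 2 * (norm f)\<^sup>2"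
    and crit: "c *\<^sub>R (\<Sum>r\<in>UNIV. (e r \<bullet> g) *\<^sub>R e r) + \<xi> + lam *\<^sub>R g = 0"
  shows "J f = J g + c / 2 * (\<Sum>r\<in>UNIV. (e r \<bullet> (f - g))\<^sup>2) + lam / 2 * (norm (f - g))\<^sup>2"
proof -
  define C where "C = (\<lambda>f. c *\<^sub>R (\<Sum>r\<in>UNIV. (e r \<bullet> f) *\<^sub>R e r))"
  have C_add: "C (f + f') = C f + C f'" for f f'
    by (simp add: C_def inner_add_right scaleR_add_left sum.distrib scaleR_add_right)
  have C_inner: "f \<bullet> C f' = c * (\<Sum>r\<in>UNIV. (e r \<bullet> f) * (e r \<bullet> f'))" for f f'
    by (simp add: C_def inner_sum_right inner_commute mult.commute)
  have C_sym: "f \<bullet> C f' = f' \<bullet> C f" for f f'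
    by (simp add: C_inner mult.commute)
  have JC: "J f = 1 / 2 * (f \<bullet> C f) + f \<bullet> \<xi> + K + lam / 2 * (norm f)\<^sup>2" for f
    by (simp add: J C_def)
  define h where "h = f - g"
  have f: "f = g + h" by (simp add: h_def)
  have "h \<bullet> (C g + \<xi> + lam *\<^sub>R g) = 0"
    using crit by (simp add: C_def)
  then have "h \<bullet> C g + h \<bullet> \<xi> + lam * (h \<bullet> g) = 0"
    by (simp add: inner_add_right)
  moreover have "J f - J g = 1 / 2 * (h \<bullet> C h) + (h \<bullet> C g + h \<bullet> \<xi> + lam * (h \<bullet> g)) + lam / 2 * (norm h)\<^sup>2"
    unfolding JC f C_add
    using C_sym[of g h] inner_commute[of g h]
    by (simp add: inner_add_left inner_add_right power2_norm_eq_inner algebra_simps)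
  moreover have "h \<bullet> C h = c * (\<Sum>r\<in>UNIV. (e r \<bullet> h)\<^sup>2)"
    by (simp add: C_inner power2_eq_square)
  ultimately show ?thesis
    by (simp add: h_def)
qed

text \<open>\<open>b \<bullet> G b = \<parallel>\<Sum> b\<^sub>r e\<^sub>r\<parallel>\<^sup>2 \<ge> 0\<close>, so the kernel of \<open>G + \<mu> I\<close> is trivial.\<close>

lemma invertible_gram_plus_scaled_identity:
  fixes e :: "'r::finite \<Rightarrow> 'h::real_inner" and G :: "real ^ 'r ^ 'r"
  assumes G: "\<And>r s. G $ r $ s = e r \<bullet> e s" and "\<mu> > 0"
  shows "invertible (G + \<mu> *\<^sub>R mat 1)"
proof -
  have G': "G $ r $ s = e s \<bullet> e r" for r s
    by (simp add: G inner_commute)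
  have "b = 0" if "(G + \<mu> *\<^sub>R mat 1) *v b = 0" for b
  proof -
    have "0 = b \<bullet> ((G + \<mu> *\<^sub>R mat 1) *v b)"
      using that by simp
    also have "\<dots> = b \<bullet> (G *v b) + \<mu> * (b \<bullet> b)"
      by (simp add: matrix_vector_mult_add_rdistrib inner_add_right scaleR_matrix_vector_assoc[symmetric])
    also have "b \<bullet> (G *v b) = (\<Sum>r\<in>UNIV. b $ r *\<^sub>R e r) \<bullet> (\<Sum>r\<in>UNIV. b $ r *\<^sub>R e r)"
      by (simp add: inner_vec_def matrix_vector_mult_def G' inner_sum_left inner_sum_right
          sum_distrib_left mult_ac)
    finally have "\<mu> * (b \<bullet> b) \<le> 0"
      using inner_ge_zero[of "\<Sum>r\<in>UNIV. b $ r *\<^sub>R e r"] by linarith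
    then have "b \<bullet> b \<le> 0"
      using \<open>\<mu> > 0\<close> by (simp add: mult_le_0_iff)
    then show "b = 0"
      using inner_ge_zero[of b] inner_eq_zero_iff[of b] by linarith
  qed
  then show ?thesis
    by (simp add: invertible_left_inverse matrix_left_invertible_ker)
qed

text \<open>Pairing \<open>g\<close> with \<open>e\<^sub>r\<close> produces \<open>(G \<beta>)\<^sub>r - h\<^sub>r / \<lambda>\<close>, which the linear system turns into
\<open>-n\<lambda>\<beta>\<^sub>r\<close>. Hence the empirical covariance sends \<open>g\<close> to \<open>-\<lambda> \<Sum> \<beta>\<^sub>r e\<^sub>r\<close> and the gradient at \<open>g\<close>
vanishes.\<close>

lemma ridge_minimizer_representer:
  fixes e :: "'r::finite \<Rightarrow> 'h::real_inner" and G :: "real ^ 'r ^ 'r"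
  assumes J: "\<And>f. J f = 1 / 2 * (f \<bullet> ((1 / n) *\<^sub>R (\<Sum>r\<in>UNIV. (e r \<bullet> f) *\<^sub>R e r))) + f \<bullet> \<xi> + K + lam / 2 * (norm f)\<^sup>2"
    and G: "\<And>r s. G $ r $ s = e r \<bullet> e s"
    and h: "\<And>r. h $ r = \<xi> \<bullet> e r"
    and "n > 0" and "lam > 0"
    and \<beta>: "(G + (n * lam) *\<^sub>R mat 1) *v \<beta> = (1 / lam) *\<^sub>R h"
    and g: "g = - (1 / lam) *\<^sub>R \<xi> + (\<Sum>r\<in>UNIV. \<beta> $ r *\<^sub>R e r)"
  shows "is_arg_min J (\<lambda>f. True) f \<longleftrightarrow> f = g"
proof -
  have eg: "e r \<bullet> g = - (n * lam) * \<beta> $ r" for r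
  proof -
    have "e r \<bullet> g = (G *v \<beta>) $ r - h $ r / lam"
      by (simp add: g inner_diff_right inner_sum_right matrix_vector_mult_def G h inner_commute mult.commute)
    moreover have "(G *v \<beta>) $ r + n * lam * \<beta> $ r = h $ r / lam"
      using arg_cong[OF \<beta>, of "\<lambda>v. v $ r"]
      by (simp add: matrix_vector_mult_add_rdistrib scaleR_matrix_vector_assoc[symmetric])
    ultimately show ?thesis by simp
  qed
  have "(1 / n) *\<^sub>R (\<Sum>r\<in>UNIV. (e r \<bullet> g) *\<^sub>R e r) = - lam *\<^sub>R (\<Sum>r\<in>UNIV. \<beta> $ r *\<^sub>R e r)"
    using \<open>n > 0\<close> by (simp add: eg scaleR_sum_right sum_negf)
  then have crit: "(1 / n) *\<^sub>R (\<Sum>r\<in>UNIV. (e r \<bullet> g) *\<^sub>R e r) + \<xi> + lam *\<^sub>R g = 0"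
    using \<open>lam > 0\<close> by (subst (2) g) (simp add: scaleR_diff_right)
  note excess = ridge_functional_at_critical_point[OF J crit]
  have less: "J g < J f" if "f \<noteq> g" for f
  proof -
    have "0 \<le> (1 / n) / 2 * (\<Sum>r\<in>UNIV. (e r \<bullet> (f - g))\<^sup>2)"
      using \<open>n > 0\<close> by (simp add: sum_nonneg)
    moreover have "0 < lam / 2 * (norm (f - g))\<^sup>2"
      using that \<open>lam > 0\<close> by simp
    ultimately show ?thesis
      using excess[of f] by linarith
  qed
  then show ?thesis
    unfolding is_arg_min_def by (metis less_asym)
qed

section \<open>The regularized score matching estimator\<close>

lemma multi_dirs_single:
  fixes i :: "'d::{finite,linorder}"
  shows "multi_dirs (\<lambda>j. if j = i then m else 0) = replicate m (dir1 i) @ replicate m (dir2 i)"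
proof -
  have "concat (map (\<lambda>j. replicate (if j = i then m else 0) (f j)) xs) =
      (if i \<in> set xs then replicate m (f i) else [])"
    if "distinct xs" for xs
    and f :: "'d::{finite,linorder} \<Rightarrow> (real ^ 'd::{finite,linorder}) \<times> (real ^ 'd::{finite,linorder})"
    using that by (induction xs) auto
  then show ?thesis
    unfolding multi_dirs_def by simp
qed

lemma kernel_smooth_if_assumption_B:
  assumes "rkhs_on_open \<Omega> fn k" and "assumption_B \<Omega> k p0" and "m \<le> 2"
  shows "rkhs_on_open.kernel_smooth \<Omega> k m (axis i 1)"
proof -
  interpret rkhs_on_open \<Omega> fn k by fact
  have "(\<Sum>j\<in>UNIV. if j = i then m else 0) \<le> 2"
    using \<open>m \<le> 2\<close> by simp
  then have "iter_pd_exists (multi_dirs (\<lambda>j. if j = i then m else 0)) k (\<Omega> \<times> \<Omega>) \<and>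
      continuous_on (\<Omega> \<times> \<Omega>) (iter_pd (multi_dirs (\<lambda>j. if j = i then m else 0)) k)"
    using \<open>assumption_B \<Omega> k p0\<close> unfolding assumption_B_def by blast
  then show ?thesis
    unfolding kernel_smooth_def multi_dirs_single dir1_def dir2_def .
qed

theorem theorem4:
  fixes \<Omega> :: "(real ^ 'd::{finite,linorder}) set"
    and k :: "(real ^ 'd::{finite,linorder}) \<times> (real ^ 'd::{finite,linorder}) \<Rightarrow> real"
    and fn :: "'h::{real_inner,complete_space} \<Rightarrow> real ^ 'd::{finite,linorder} \<Rightarrow> real"
    and q0 p0 :: "real ^ 'd::{finite,linorder} \<Rightarrow> real"
    and f0 :: 'h
    and M :: "'w measure"
    and X :: "'n::finite \<Rightarrow> 'w \<Rightarrow> real ^ 'd::{finite,linorder}"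
    and lam :: real
  assumes "rkhs \<Omega> fn k"
    and "prob_density_on \<Omega> q0"
    and "f0 \<in> expfam_dom \<Omega> fn q0"
    and "p0 = expfam_density \<Omega> fn q0 f0"
    and "assumption_A \<Omega>"
    and "assumption_B \<Omega> k p0"
    and "assumption_C \<Omega> k p0"
    and "assumption_D 1 \<Omega> k q0 p0"
    and "prob_space M"
    and "prob_space.indep_vars M (\<lambda>_. restrict_space lborel \<Omega>) X UNIV"
    and "\<And>a. distributed M (restrict_space lborel \<Omega>) (X a) (\<lambda>x. ennreal (p0 x))"
    and "lam > 0"
  shows "(\<forall>x\<in>\<Omega>. \<forall>i. in_rkhs \<Omega> fn (dk_fun k i x) \<and> in_rkhs \<Omega> fn (ddk_fun k i x)) \<and>
    (\<forall>\<omega>\<in>space M.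
      let x = (\<lambda>a. X a \<omega>);
          Jh = J_hat \<Omega> fn k q0 p0 lam x;
          f_lam_n = arg_min Jh (\<lambda>f. True);
          A = G_mat k x + (real CARD('n) * lam) *\<^sub>R mat 1;
          h = h_vec \<Omega> fn k q0 x
      in (\<exists>!f. is_arg_min Jh (\<lambda>f. True) f) \<and>
         (\<exists>!\<beta>. A *v \<beta> = (1 / lam) *\<^sub>R h) \<and>
         (\<forall>\<beta>. A *v \<beta> = (1 / lam) *\<^sub>R h \<longrightarrow>
            f_lam_n = - (1 / lam) *\<^sub>R xi_hat \<Omega> fn k q0 x +
              (\<Sum>a\<in>UNIV. \<Sum>i\<in>UNIV. (\<beta> $ (a, i)) *\<^sub>R rkhs_elem \<Omega> fn (dk_fun k i (x a)))) \<and>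
         (\<forall>a i. h $ (a, i) =
            (1 / real CARD('n)) *
              (\<Sum>b\<in>UNIV. \<Sum>j\<in>UNIV.
                 iter_pd [dir1 i, dir2 j, dir2 j] k (x a, x b) +
                 iter_pd [dir1 i, dir2 j] k (x a, x b) * (grad (\<lambda>x. ln (q0 x)) (x b) $ j))))"
proof -
  interpret rkhs_on_open \<Omega> fn k
    using assms(1,5) by (simp add: rkhs_on_open_def rkhs_on_open_axioms_def assumption_A_def)
  have smooth: "kernel_smooth m (axis i 1)" if "m \<le> 2" for m and i :: 'd
    by (rule kernel_smooth_if_assumption_B[OF rkhs_on_open_axioms assms(6) that])
  have smooth1: "kernel_smooth 1 (axis i 1)" and smooth2: "kernel_smooth 2 (axis i 1)" for i :: 'd
    by (simp_all add: smooth)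
  have dk: "dk_fun k i x = (\<lambda>y. iter_pd (replicate 1 (axis i 1, 0)) k (x, y))"
    and ddk: "ddk_fun k i x = (\<lambda>y. iter_pd (replicate 2 (axis i 1, 0)) k (x, y))"
    for i :: 'd and x
    by (simp_all add: dk_fun_def ddk_fun_def dir1_def numeral_2_eq_2)
  have in_H: "in_rkhs \<Omega> fn (dk_fun k i x) \<and> in_rkhs \<Omega> fn (ddk_fun k i x)" if "x \<in> \<Omega>" for x i
    unfolding dk ddk using that in_rkhs_deriv smooth1 smooth2 by blast
  define E where "E = (\<lambda>i x. rkhs_elem \<Omega> fn (dk_fun k i x))"
  have E_inner_E: "E i x \<bullet> E j y = iter_pd [dir1 i, dir2 j] k (x, y)"
    and E_inner_EE: "E i x \<bullet> rkhs_elem \<Omega> fn (ddk_fun k j y) = iter_pd [dir1 i, dir2 j, dir2 j] k (x, y)"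
    if "x \<in> \<Omega>" "y \<in> \<Omega>" for i j x y
    using inner_deriv_features[OF smooth1 smooth1 that, of i j]
      inner_deriv_features[OF smooth1 smooth2 that, of i j]
    unfolding E_def dk ddk deriv_feature_def dir1_def dir2_def
    by (simp_all add: numeral_2_eq_2)
  show ?thesis
  proof (intro conjI ballI allI, goal_cases)
    case (3 \<omega>)
    define x where "x = (\<lambda>a. X a \<omega>)"
    define Jh where "Jh = J_hat \<Omega> fn k q0 p0 lam x"
    define A where "A = G_mat k x + (real CARD('n) * lam) *\<^sub>R mat 1"
    define h where "h = h_vec \<Omega> fn k q0 x"
    define \<xi> where "\<xi> = xi_hat \<Omega> fn k q0 x"
    define e where "e = (\<lambda>r :: 'n \<times> 'd. E (snd r) (x (fst r)))"
    have x: "x a \<in> \<Omega>" for a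
    proof -
      have "X a \<in> measurable M (restrict_space lborel \<Omega>)"
        using assms(11)[of a] by (rule distributed_measurable)
      from measurable_space[OF this 3] show ?thesis
        by (simp add: x_def space_restrict_space)
    qed
    have double_sum: "(\<Sum>a\<in>UNIV. \<Sum>i\<in>UNIV. g (a, i)) = (\<Sum>r\<in>UNIV. g r)"
      for g :: "'n \<times> 'd \<Rightarrow> 'h"
      by (simp add: sum.cartesian_product)
    have G: "G_mat k x $ r $ s = e r \<bullet> e s" for r s
      by (simp add: G_mat_def e_def E_inner_E x)
    have h_e: "h $ r = \<xi> \<bullet> e r" for r
      by (simp add: h_def h_vec_def \<xi>_def e_def E_def)
    have J: "Jh f = 1 / 2 * (f \<bullet> ((1 / real CARD('n)) *\<^sub>R (\<Sum>r\<in>UNIV. (e r \<bullet> f) *\<^sub>R e r))) +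
        f \<bullet> \<xi> + fisher_div \<Omega> p0 q0 + lam / 2 * (norm f)\<^sup>2" for f
      unfolding Jh_def J_hat_def C_hat_def \<xi>_def double_sum[symmetric] outer_def
      by (simp add: e_def E_def)
    have n: "real CARD('n) > 0"
      by simp
    have A_invertible: "invertible A"
      unfolding A_def using \<open>lam > 0\<close> by (intro invertible_gram_plus_scaled_identity[OF G]) simp
    have \<beta>_unique: "\<exists>!\<beta>. A *v \<beta> = (1 / lam) *\<^sub>R h"
    proof -
      obtain B where B: "A ** B = mat 1" "B ** A = mat 1"
        using A_invertible unfolding invertible_def by blast
      have "A *v (B *v b) = b" "B *v (A *v b) = b" for b
        by (simp_all add: matrix_vector_mul_assoc B)
      then show ?thesis
        by metis
    qed
    have argmin: "is_arg_min Jh (\<lambda>f. True) f \<longleftrightarrow>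
        f = - (1 / lam) *\<^sub>R \<xi> + (\<Sum>a\<in>UNIV. \<Sum>i\<in>UNIV. \<beta> $ (a, i) *\<^sub>R rkhs_elem \<Omega> fn (dk_fun k i (x a)))"
      if "A *v \<beta> = (1 / lam) *\<^sub>R h" for \<beta> f
    proof -
      have "is_arg_min Jh (\<lambda>f. True) f \<longleftrightarrow>
          f = - (1 / lam) *\<^sub>R \<xi> + (\<Sum>r\<in>UNIV. \<beta> $ r *\<^sub>R e r)"
        using that unfolding A_def
        by (intro ridge_minimizer_representer[OF J G h_e n \<open>lam > 0\<close> _ refl])
      then show ?thesis
        unfolding double_sum[symmetric] by (simp add: e_def E_def)
    qed
    obtain \<beta>\<^sub>0 where "A *v \<beta>\<^sub>0 = (1 / lam) *\<^sub>R h"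
      using \<beta>_unique by blast
    then have "\<exists>!f. is_arg_min Jh (\<lambda>f. True) f"
      by (simp add: argmin)
    moreover have "arg_min Jh (\<lambda>f. True) =
        - (1 / lam) *\<^sub>R \<xi> + (\<Sum>a\<in>UNIV. \<Sum>i\<in>UNIV. \<beta> $ (a, i) *\<^sub>R rkhs_elem \<Omega> fn (dk_fun k i (x a)))"
      if "A *v \<beta> = (1 / lam) *\<^sub>R h" for \<beta>
      unfolding arg_min_def argmin[OF that] by simp
    moreover have "h $ (a, i) = (1 / real CARD('n)) *
        (\<Sum>b\<in>UNIV. \<Sum>j\<in>UNIV.
           iter_pd [dir1 i, dir2 j, dir2 j] k (x a, x b) +
           iter_pd [dir1 i, dir2 j] k (x a, x b) * (grad (\<lambda>x. ln (q0 x)) (x b) $ j))" for a i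
    proof -
      have "h $ (a, i) = E i (x a) \<bullet> \<xi>"
        by (simp add: h_e e_def inner_commute)
      also have "\<dots> = (1 / real CARD('n)) * (\<Sum>b\<in>UNIV. \<Sum>j\<in>UNIV.
          grad (\<lambda>x. ln (q0 x)) (x b) $ j * (E i (x a) \<bullet> E j (x b)) +
          E i (x a) \<bullet> rkhs_elem \<Omega> fn (ddk_fun k j (x b)))"
        unfolding \<xi>_def xi_hat_def E_def
        by (simp add: inner_sum_right inner_add_right)
      finally show ?thesis
        by (simp only: E_inner_E E_inner_EE x add.commute mult.commute)
    qed
    ultimately show ?case
      unfolding Let_def x_def[symmetric] Jh_def[symmetric] A_def[symmetric] h_def[symmetric]
        \<xi>_def[symmetric]
      using \<beta>_unique by (intro conjI allI impI)
  qed (use in_H in blast)+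
qed

end
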